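(* Let $d\ge 1$, $q\ge 0$, let $\Omega\subseteq\mathbf{R}^d$ be a region and $w\ge 0$ a suitable weight function on $\Omega$, and let $A_1,\dots,A_d$ be matrix representations of the operators $\chi_1,\dots,\chi_d$ on $\mathcal{P}_q$. In any degree $2q+1$, $d$-dimensional, positive weight cubature rule for $\Omega$ and $w$, and for each $i\in\{1,\dots,d\}$, there is a node $x_\alpha$ whose $i$-th coordinate $(x_\alpha)_i$ is less than or equal to the smallest eigenvalue of $A_i$, and a node $x_\beta$ whose $i$-th coordinate $(x_\beta)_i$ is greater than or equal to the largest eigenvalue of $A_i$.
   Context: "Suitable" weight: $\Omega\subseteq\mathbf{R}^d$ and $w:\Omega\to[0,\infty)$ are measurable, $\int_\Omega w(x)|p(x)|\,d^dx<\infty$ for every polynomial $p$, and $\int_\Omega w(x)p(x)^2\,d^dx>0$ for every nonzero polynomial $p$. $\mathcal{P}_m$ is the real vector space of polynomials in $x_1,\dots,x_d$ of total degree at most $m$, with inner product $\langle a|b\rangle=\int_\Omega w(x)a(x)b(x)\,d^dx$. $\Pi_q:\mathcal{P}_{q+1}\to\mathcal{P}_q$ is the orthogonal projection with respect to this inner product, and $\chi_i:\mathcal{P}_q\to\mathcal{P}_q$ is the (self-adjoint) operator $\chi_ip=\Pi_q(x_ip)$. The matrix representations are taken in an arbitrary orthonormal basis $\{e_a\}$ of $\mathcal{P}_q$: $(A_i)_{ab}=\langle e_a|\chi_ie_b\rangle$. A positive weight cubature rule, $\int_\Omega w(x)f(x)\,d^dx\approx\sum_{\alpha=1}^N w_\alpha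 f(x_\alpha)$, consists of nodes $x_\alpha\in\mathbf{R}^d$ and weights $w_\alpha>0$, $\alpha=1,\dots,N$. It is of degree $D$ if it is exact (equality holds) for every polynomial $f$ of total degree at most $D$ and non-exact for at least one polynomial of total degree $D+1$. *)

theory Defs
  imports "HOL-Analysis.Analysis" "Jordan_Normal_Form.Spectral_Radius"
begin

text \<open>The symbol \<open>$\<close> below always means the component of a vector in \<open>real ^ 'd\<close>.\<close>

no_notation Matrix.vec_index (infixl "$" 100)

text \<open>
  Polynomials in the coordinates of \<open>real ^ 'd\<close> are represented by the functions they induce;
  this is faithful, including the total degree, because the field of reals is infinite.
\<close>

definition polys :: "nat \<Rightarrow> (real ^ 'd \<Rightarrow> real) set" where
  "polys m = {p. \<exists>c :: ('d \<Rightarrow> nat) \<Rightarrow> real.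
     p = (\<lambda>x. \<Sum>k | (\<Sum>i\<in>UNIV. k i) \<le> m. c k * (\<Prod>i\<in>UNIV. (x $ i) ^ k i))}"

lemma finite_exponents: "finite {k :: 'd::finite \<Rightarrow> nat. (\<Sum>i\<in>UNIV. k i) \<le> m}"
proof (rule finite_subset)
  show "{k :: 'd \<Rightarrow> nat. (\<Sum>i\<in>UNIV. k i) \<le> m} \<subseteq> PiE UNIV (\<lambda>_. {..m})"
  proof
    fix k :: "'d \<Rightarrow> nat"
    assume "k \<in> {k. (\<Sum>i\<in>UNIV. k i) \<le> m}"
    then have "k j \<le> m" for j
      using member_le_sum[of j UNIV k] by simp
    then show "k \<in> PiE UNIV (\<lambda>_. {..m})"
      by (simp add: PiE_iff)
  qed
  show "finite (PiE (UNIV :: 'd set) (\<lambda>_. {..m}))"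
    by (rule finite_PiE) auto
qed

definition suitable_weight :: "(real ^ 'd) set \<Rightarrow> (real ^ 'd \<Rightarrow> real) \<Rightarrow> bool" where
  "suitable_weight \<Omega> w \<longleftrightarrow>
     \<Omega> \<in> sets lebesgue \<and>
     set_borel_measurable lebesgue \<Omega> w \<and>
     (\<forall>x\<in>\<Omega>. 0 \<le> w x) \<and>
     (\<forall>m. \<forall>p\<in>polys m. set_integrable lebesgue \<Omega> (\<lambda>x. w x * \<bar>p x\<bar>)) \<and>
     (\<forall>m. \<forall>p\<in>polys m. p \<noteq> (\<lambda>x. 0) \<longrightarrow> 0 < (LINT x:\<Omega>|lebesgue. w x * (p x)\<^sup>2))"

definition wprod ::
  "(real ^ 'd) set \<Rightarrow> (real ^ 'd \<Rightarrow> real) \<Rightarrow> (real ^ 'd \<Rightarrow> real) \<Rightarrow> (real ^ 'd \<Rightarrow> real) \<Rightarrow> real" where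
  "wprod \<Omega> w a b = (LINT x:\<Omega>|lebesgue. w x * a x * b x)"

text \<open>
  The orthogonal projection onto \<open>polys q\<close>; for a suitable weight and a polynomial \<open>p\<close> the
  described element exists and is unique.
\<close>

definition proj_polys ::
  "(real ^ 'd) set \<Rightarrow> (real ^ 'd \<Rightarrow> real) \<Rightarrow> nat \<Rightarrow> (real ^ 'd \<Rightarrow> real) \<Rightarrow> (real ^ 'd \<Rightarrow> real)" where
  "proj_polys \<Omega> w q p =
     (THE r. r \<in> polys q \<and> (\<forall>s\<in>polys q. wprod \<Omega> w (\<lambda>x. p x - r x) s = 0))"

definition chi_op ::
  "(real ^ 'd) set \<Rightarrow> (real ^ 'd \<Rightarrow> real) \<Rightarrow> nat \<Rightarrow> 'd \<Rightarrow> (real ^ 'd \<Rightarrow> real) \<Rightarrow> (real ^ 'd \<Rightarrow> real)" where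
  "chi_op \<Omega> w q i p = proj_polys \<Omega> w q (\<lambda>x. x $ i * p x)"

definition orthonormal_basis_polys ::
  "(real ^ 'd) set \<Rightarrow> (real ^ 'd \<Rightarrow> real) \<Rightarrow> nat \<Rightarrow> nat \<Rightarrow> (nat \<Rightarrow> real ^ 'd \<Rightarrow> real) \<Rightarrow> bool" where
  "orthonormal_basis_polys \<Omega> w q n e \<longleftrightarrow>
     (\<forall>a<n. e a \<in> polys q) \<and>
     (\<forall>a<n. \<forall>b<n. wprod \<Omega> w (e a) (e b) = (if a = b then 1 else 0)) \<and>
     (\<forall>p\<in>polys q. \<exists>c :: nat \<Rightarrow> real. p = (\<lambda>x. \<Sum>a<n. c a * e a x))"

text \<open>
  For an orthonormal basis of \<open>polys q\<close> this matrix is symmetric and \<open>n > 0\<close>, so its set of real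
  eigenvalues is finite and nonempty, and has a minimum and a maximum.
\<close>

definition chi_mat ::
  "(real ^ 'd) set \<Rightarrow> (real ^ 'd \<Rightarrow> real) \<Rightarrow> nat \<Rightarrow> nat \<Rightarrow> (nat \<Rightarrow> real ^ 'd \<Rightarrow> real) \<Rightarrow> 'd \<Rightarrow> real Matrix.mat" where
  "chi_mat \<Omega> w q n e i = Matrix.mat n n (\<lambda>(a, b). wprod \<Omega> w (e a) (chi_op \<Omega> w q i (e b)))"

definition cubature_exact ::
  "(real ^ 'd) set \<Rightarrow> (real ^ 'd \<Rightarrow> real) \<Rightarrow> nat \<Rightarrow> (nat \<Rightarrow> real ^ 'd) \<Rightarrow> (nat \<Rightarrow> real) \<Rightarrow>
    (real ^ 'd \<Rightarrow> real) \<Rightarrow> bool" where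
  "cubature_exact \<Omega> w N node wt f \<longleftrightarrow>
     (LINT x:\<Omega>|lebesgue. w x * f x) = (\<Sum>\<alpha>=1..N. wt \<alpha> * f (node \<alpha>))"

text \<open>The nodes need neither lie in \<open>\<Omega>\<close> nor be pairwise distinct.\<close>

definition positive_cubature_rule ::
  "(real ^ 'd) set \<Rightarrow> (real ^ 'd \<Rightarrow> real) \<Rightarrow> nat \<Rightarrow> nat \<Rightarrow> (nat \<Rightarrow> real ^ 'd) \<Rightarrow> (nat \<Rightarrow> real) \<Rightarrow> bool" where
  "positive_cubature_rule \<Omega> w D N node wt \<longleftrightarrow>
     (\<forall>\<alpha>\<in>{1..N}. 0 < wt \<alpha>) \<and>
     (\<forall>f\<in>polys D. cubature_exact \<Omega> w N node wt f) \<and>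
     (\<exists>f\<in>polys (D + 1) - polys D. \<not> cubature_exact \<Omega> w N node wt f)"

end

theory Submission
  imports Defs
begin

text \<open>
  Let \<open>v\<close> be an eigenvector of the matrix of \<open>\<chi>\<^sub>i\<close> for the eigenvalue \<open>k\<close>, and let \<open>p\<close> be the
  polynomial with coordinates \<open>v\<close>. Since \<open>p\<close> has degree at most \<open>q\<close>, the projection drops out of
  \<open>\<langle>p|\<chi>\<^sub>i p\<rangle>\<close>, so the integral of \<open>w x\<^sub>i p\<^sup>2\<close> is \<open>k\<close> times the integral of \<open>w p\<^sup>2\<close>, which is positive. Both integrands
  are within the exactness range of the rule, so \<open>k\<close> is a weighted mean of the \<open>i\<close>-th coordinates
  of the nodes, with nonnegative weights \<open>w\<^sub>\<alpha> p(x\<^sub>\<alpha>)\<^sup>2\<close>. Hence some node lies on each side of \<open>k\<close>.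
\<close>

section \<open>Polynomial functions\<close>

lemma polys_add:
  assumes "f \<in> polys m" "g \<in> polys m"
  shows "(\<lambda>x. f x + g x) \<in> polys m"
proof -
  obtain c d where
    "f = (\<lambda>x. \<Sum>k | (\<Sum>i\<in>UNIV. k i) \<le> m. c k * (\<Prod>i\<in>UNIV. (x $ i) ^ k i))"
    "g = (\<lambda>x. \<Sum>k | (\<Sum>i\<in>UNIV. k i) \<le> m. d k * (\<Prod>i\<in>UNIV. (x $ i) ^ k i))"
    using assms unfolding polys_def by blast
  then show ?thesis
    unfolding polys_def
    by (auto intro!: exI[of _ "\<lambda>k. c k + d k"] simp: algebra_simps sum.distrib)
qed

lemma polys_cmult:
  assumes "f \<in> polys m"
  shows "(\<lambda>x. a * f x) \<in> polys m"
proof -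
  obtain c where
    "f = (\<lambda>x. \<Sum>k | (\<Sum>i\<in>UNIV. k i) \<le> m. c k * (\<Prod>i\<in>UNIV. (x $ i) ^ k i))"
    using assms unfolding polys_def by blast
  then show ?thesis
    unfolding polys_def
    by (auto intro!: exI[of _ "\<lambda>k. a * c k"] simp: sum_distrib_left mult.assoc)
qed

lemma polys_zero: "(\<lambda>x. 0) \<in> polys m"
  unfolding polys_def by (auto intro!: exI[of _ "\<lambda>k. 0"])

lemma polys_diff:
  assumes "f \<in> polys m" "g \<in> polys m"
  shows "(\<lambda>x. f x - g x) \<in> polys m"
  using polys_add[OF assms(1) polys_cmult[OF assms(2), of "-1"]] by simp

lemma polys_sum:
  assumes "\<And>a. a \<in> S \<Longrightarrow> f a \<in> polys m"
  shows "(\<lambda>x. \<Sum>a\<in>S. f a x) \<in> polys m"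
  using assms
proof (induction S rule: infinite_finite_induct)
  case (insert a S)
  then show ?case using polys_add[of "f a" m "\<lambda>x. \<Sum>a\<in>S. f a x"] by simp
qed (simp_all add: polys_zero)

lemma monomial_in_polys:
  fixes k :: "'d::finite \<Rightarrow> nat"
  assumes "(\<Sum>i\<in>UNIV. k i) \<le> m"
  shows "(\<lambda>x. \<Prod>i\<in>UNIV. (x $ i) ^ k i) \<in> polys m"
  unfolding polys_def
proof (intro CollectI exI ext)
  fix x :: "real ^ 'd"
  \<comment> \<open>The coefficient family is the indicator of \<open>k\<close>, so the bound on the
    exponent sum keeps exactly the wanted term.\<close>
  have "(\<Sum>l | (\<Sum>i\<in>UNIV. l i) \<le> m. (if l = k then 1 else 0) * (\<Prod>i\<in>UNIV. (x $ i) ^ l i))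
      = (\<Sum>l | (\<Sum>i\<in>UNIV. l i) \<le> m. if l = k then \<Prod>i\<in>UNIV. (x $ i) ^ l i else 0)"
    by (intro sum.cong) auto
  also have "\<dots> = (\<Prod>i\<in>UNIV. (x $ i) ^ k i)"
    using assms by (simp add: sum.delta' finite_exponents)
  finally show "(\<Prod>i\<in>UNIV. (x $ i) ^ k i) = (\<Sum>l | (\<Sum>i\<in>UNIV. l i) \<le> m.
      (if l = k then 1 else 0) * (\<Prod>i\<in>UNIV. (x $ i) ^ l i))" by simp
qed

text \<open>Collecting coefficients would require a convolution, since different pairs
  \<open>(k, l)\<close> can give the same exponent. The expanded product is instead treated as a
  double sum of scaled monomials, each of degree at most \<open>m + n\<close>, and closure under
  sums finishes.\<close>

lemma polys_mult:
  assumes "f \<in> polys m" "g \<in> polys n"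
  shows "(\<lambda>x. f x * g x) \<in> polys (m + n)"
proof -
  obtain c d where
    f: "f = (\<lambda>x. \<Sum>k | (\<Sum>i\<in>UNIV. k i) \<le> m. c k * (\<Prod>i\<in>UNIV. (x $ i) ^ k i))" and
    g: "g = (\<lambda>x. \<Sum>l | (\<Sum>i\<in>UNIV. l i) \<le> n. d l * (\<Prod>i\<in>UNIV. (x $ i) ^ l i))"
    using assms unfolding polys_def by blast
  have "(\<lambda>x. f x * g x) = (\<lambda>x. \<Sum>k | (\<Sum>i\<in>UNIV. k i) \<le> m. \<Sum>l | (\<Sum>i\<in>UNIV. l i) \<le> n.
      (c k * d l) * (\<Prod>i\<in>UNIV. (x $ i) ^ (k i + l i)))"
    by (simp add: f g sum_product power_add prod.distrib mult_ac)
  also have "\<dots> \<in> polys (m + n)"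
    by (intro polys_sum polys_cmult monomial_in_polys) (auto simp: sum.distrib)
  finally show ?thesis .
qed

lemma polys_mono: "m \<le> n \<Longrightarrow> f \<in> polys m \<Longrightarrow> f \<in> polys n"
proof -
  assume "m \<le> n" "f \<in> polys m"
  then obtain c where
    "f = (\<lambda>x. \<Sum>k | (\<Sum>i\<in>UNIV. k i) \<le> m. c k * (\<Prod>i\<in>UNIV. (x $ i) ^ k i))"
    unfolding polys_def by blast
  also have "\<dots> \<in> polys n"
    using \<open>m \<le> n\<close> by (intro polys_sum polys_cmult monomial_in_polys) auto
  finally show ?thesis .
qed

lemma const_in_polys: "(\<lambda>x. c) \<in> polys m"
  using polys_cmult[OF monomial_in_polys[of "\<lambda>_. 0" m], of c] by simp

lemma coordinate_in_polys: "(\<lambda>x. x $ i) \<in> polys 1"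
proof -
  have "(\<Prod>j\<in>UNIV. (x $ j) ^ (if j = i then 1 else 0)) = x $ i" for x :: "real ^ 'a"
  proof -
    have "(\<Prod>j\<in>UNIV. (x $ j) ^ (if j = i then 1 else 0)) = (\<Prod>j\<in>UNIV. if j = i then x $ j else 1)"
      by (intro prod.cong) auto
    then show ?thesis by (simp add: prod.delta')
  qed
  then show ?thesis
    using monomial_in_polys[of "\<lambda>j. if j = i then 1 else 0" 1] by simp
qed

lemma coordinate_mult_in_polys: "p \<in> polys m \<Longrightarrow> (\<lambda>x. x $ i * p x) \<in> polys (m + 1)"
  using polys_mult[OF coordinate_in_polys, of p m i] by (simp add: add.commute)

lemma continuous_on_polys: "f \<in> polys m \<Longrightarrow> continuous_on UNIV f"
  unfolding polys_def by (auto intro!: continuous_intros)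

section \<open>The weighted inner product\<close>

text \<open>Suitability speaks of \<open>\<bar>f x\<bar>\<close> only. Measurability without the
  absolute value comes from continuity of \<open>f\<close> and measurability of \<open>w\<close> on
  \<open>\<Omega>\<close>; domination then gives integrability.\<close>

lemma set_integrable_polys:
  assumes w: "suitable_weight \<Omega> w" and f: "f \<in> polys m"
  shows "set_integrable lebesgue \<Omega> (\<lambda>x. w x * f x)"
proof -
  have "set_integrable lebesgue \<Omega> (\<lambda>x. w x * \<bar>f x\<bar>)"
    using w f unfolding suitable_weight_def by blast
  moreover have "(\<lambda>x. indicator \<Omega> x *\<^sub>R (w x * f x)) \<in> borel_measurable lebesgue"
  proof -
    have "f \<in> borel_measurable lebesgue"
      using borel_measurable_continuous_onI[OF continuous_on_polys[OF f]]
      by (simp add: measurable_completion)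
    moreover have "(\<lambda>x. indicator \<Omega> x *\<^sub>R w x) \<in> borel_measurable lebesgue"
      using w unfolding suitable_weight_def set_borel_measurable_def by blast
    ultimately have "(\<lambda>x. (indicator \<Omega> x *\<^sub>R w x) * f x) \<in> borel_measurable lebesgue"
      by (rule borel_measurable_times[rotated])
    then show ?thesis by (simp add: mult.assoc)
  qed
  ultimately show ?thesis
    unfolding set_integrable_def
    by (rule Bochner_Integration.integrable_bound) (auto simp: abs_mult)
qed

lemma wprod_commute: "wprod \<Omega> w a b = wprod \<Omega> w b a"
  unfolding wprod_def by (simp add: mult_ac)

text \<open>Multiplication by a fixed function is symmetric for the inner product. With
  \<open>c\<close> a coordinate, this is the source of the symmetry of the matrix of \<chi>.\<close>

lemma wprod_swap: "wprod \<Omega> w a (\<lambda>x. c x * b x) = wprod \<Omega> w b (\<lambda>x. c x * a x)"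
  unfolding wprod_def by (simp add: mult_ac)

lemma wprod_sum_right:
  assumes w: "suitable_weight \<Omega> w" and a: "a \<in> polys m"
    and f: "\<And>j. j \<in> S \<Longrightarrow> f j \<in> polys n"
  shows "wprod \<Omega> w a (\<lambda>x. \<Sum>j\<in>S. c j * f j x) = (\<Sum>j\<in>S. c j * wprod \<Omega> w a (f j))"
proof -
  have int: "set_integrable lebesgue \<Omega> (\<lambda>x. c j * (w x * (a x * f j x)))" if "j \<in> S" for j
    using set_integrable_polys[OF w polys_mult[OF a f[OF that]]] by simp
  have "(LINT x:\<Omega>|lebesgue. \<Sum>j\<in>S. c j * (w x * (a x * f j x)))
      = (\<Sum>j\<in>S. LINT x:\<Omega>|lebesgue. c j * (w x * (a x * f j x)))"
    using int unfolding set_integrable_def set_lebesgue_integral_def scaleR_sum_right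
    by (rule Bochner_Integration.integral_sum)
  also have "\<dots> = (\<Sum>j\<in>S. c j * (LINT x:\<Omega>|lebesgue. w x * (a x * f j x)))"
    by (simp only: set_integral_mult_right)
  also have "(\<lambda>x. \<Sum>j\<in>S. c j * (w x * (a x * f j x))) = (\<lambda>x. w x * a x * (\<Sum>j\<in>S. c j * f j x))"
    by (simp add: sum_distrib_left mult_ac)
  finally show ?thesis
    by (simp only: wprod_def mult.assoc)
qed

lemma wprod_diff_left:
  assumes w: "suitable_weight \<Omega> w" and "a \<in> polys m" "b \<in> polys n" "c \<in> polys k"
  shows "wprod \<Omega> w (\<lambda>x. a x - b x) c = wprod \<Omega> w a c - wprod \<Omega> w b c"
  using set_integral_diff(2)[OF set_integrable_polys[OF w polys_mult[OF assms(2,4)]]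
      set_integrable_polys[OF w polys_mult[OF assms(3,4)]]]
  unfolding wprod_def by (simp add: algebra_simps)

lemma wprod_self_pos:
  assumes "suitable_weight \<Omega> w" "p \<in> polys m" "p \<noteq> (\<lambda>x. 0)"
  shows "0 < wprod \<Omega> w p p"
  using assms unfolding suitable_weight_def wprod_def by (simp add: power2_eq_square mult.assoc)

text \<open>Two candidates differ by an element of \<open>polys q\<close> orthogonal to all of
  \<open>polys q\<close>, hence to itself; positivity of the weight forces it to vanish.\<close>

lemma proj_polys_eqI:
  assumes w: "suitable_weight \<Omega> w" and p: "p \<in> polys m" and r: "r \<in> polys q"
    and orth: "\<And>s. s \<in> polys q \<Longrightarrow> wprod \<Omega> w (\<lambda>x. p x - r x) s = 0"
  shows "proj_polys \<Omega> w q p = r"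
  unfolding proj_polys_def
proof (rule the_equality)
  fix r' assume r': "r' \<in> polys q \<and> (\<forall>s\<in>polys q. wprod \<Omega> w (\<lambda>x. p x - r' x) s = 0)"
  let ?u = "\<lambda>x. r x - r' x"
  have u: "?u \<in> polys q" using r r' polys_diff by blast
  have r'q: "r' \<in> polys q" using r' by blast
  have "wprod \<Omega> w ?u ?u = wprod \<Omega> w (\<lambda>x. p x - r' x) ?u - wprod \<Omega> w (\<lambda>x. p x - r x) ?u"
    unfolding wprod_diff_left[OF w r r'q u] wprod_diff_left[OF w p r'q u] wprod_diff_left[OF w p r u]
    by simp
  also have "\<dots> = 0" using r' orth[OF u] u by simp
  finally have "?u = (\<lambda>x. 0)" using wprod_self_pos[OF w u] by force
  then show "r' = r" by (metis eq_iff_diff_eq_0 ext)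
qed (use r orth in auto)

section \<open>The matrix of the multiplication operator\<close>

lemma wprod_basis_sum:
  assumes w: "suitable_weight \<Omega> w" and e: "orthonormal_basis_polys \<Omega> w q n e" and a: "a < n"
  shows "wprod \<Omega> w (e a) (\<lambda>x. \<Sum>b<n. v b * e b x) = v a"
proof -
  have "e b \<in> polys q" if "b < n" for b
    using e that unfolding orthonormal_basis_polys_def by blast
  then have "wprod \<Omega> w (e a) (\<lambda>x. \<Sum>b<n. v b * e b x) = (\<Sum>b<n. v b * wprod \<Omega> w (e a) (e b))"
    using a by (intro wprod_sum_right[OF w, where m = q and n = q]) auto
  also have "\<dots> = (\<Sum>b<n. if b = a then v b else 0)"
    using e a by (intro sum.cong) (auto simp: orthonormal_basis_polys_def)
  also have "\<dots> = v a" using a by simp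
  finally show ?thesis .
qed

text \<open>The Fourier sum of \<open>p\<close> in the orthonormal basis leaves a remainder
  orthogonal to every basis element, so it is the projection. Pairing with a basis element therefore
  does not see the projection.\<close>

lemma wprod_proj_polys:
  assumes w: "suitable_weight \<Omega> w" and e: "orthonormal_basis_polys \<Omega> w q n e"
    and p: "p \<in> polys m" and a: "a < n"
  shows "wprod \<Omega> w (e a) (proj_polys \<Omega> w q p) = wprod \<Omega> w (e a) p"
proof -
  have ein: "e b \<in> polys q" if "b < n" for b
    using e that unfolding orthonormal_basis_polys_def by blast
  define r where "r = (\<lambda>x. \<Sum>b<n. wprod \<Omega> w (e b) p * e b x)"
  have r: "r \<in> polys q"
    unfolding r_def using ein by (intro polys_sum polys_cmult) auto
  have er: "wprod \<Omega> w (e b) r = wprod \<Omega> w (e b) p" if "b < n" for b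
    unfolding r_def by (rule wprod_basis_sum[OF w e that])
  have "proj_polys \<Omega> w q p = r"
  proof (rule proj_polys_eqI[OF w p r])
    fix s :: "real ^ 'a \<Rightarrow> real" assume "s \<in> polys q"
    then obtain c where s: "s = (\<lambda>x. \<Sum>b<n. c b * e b x)"
      using e unfolding orthonormal_basis_polys_def by blast
    \<comment> \<open>The degree \<open>m\<close> of \<open>p\<close> is arbitrary, so the remainder
      is placed in the larger of the two spaces.\<close>
    have pr: "(\<lambda>x. p x - r x) \<in> polys (max m q)"
      using p r by (intro polys_diff) (auto intro: polys_mono[rotated])
    have "wprod \<Omega> w (\<lambda>x. p x - r x) s = (\<Sum>b<n. c b * wprod \<Omega> w (\<lambda>x. p x - r x) (e b))"
      unfolding s using ein by (intro wprod_sum_right[OF w pr]) auto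
    also have "\<dots> = 0"
      using er wprod_diff_left[OF w p r ein]
      by (intro sum.neutral) (auto simp: wprod_commute[of \<Omega> w p] wprod_commute[of \<Omega> w r])
    finally show "wprod \<Omega> w (\<lambda>x. p x - r x) s = 0" .
  qed
  then show ?thesis using er[OF a] by simp
qed

lemma chi_mat_carrier: "chi_mat \<Omega> w q n e i \<in> carrier_mat n n"
  by (simp add: chi_mat_def)

lemma chi_mat_entry:
  assumes "suitable_weight \<Omega> w" "orthonormal_basis_polys \<Omega> w q n e" "a < n" "b < n"
  shows "chi_mat \<Omega> w q n e i $$ (a, b) = wprod \<Omega> w (e a) (\<lambda>x. x $ i * e b x)"
proof -
  have "e b \<in> polys q"
    using assms unfolding orthonormal_basis_polys_def by blast
  then show ?thesis
    using wprod_proj_polys[OF assms(1,2) coordinate_mult_in_polys assms(3)] assms(3,4)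
    by (simp add: chi_mat_def chi_op_def)
qed

section \<open>Eigenvalues of symmetric matrices\<close>

lemma eigenvalue_coordinatesE:
  assumes A: "A \<in> carrier_mat n n" and ev: "eigenvalue A k"
  obtains v where "\<exists>a<n. v a \<noteq> 0" "\<And>a. a < n \<Longrightarrow> (\<Sum>b<n. A $$ (a, b) * v b) = k * v a"
proof -
  obtain u where u: "u \<in> carrier_vec n" "u \<noteq> 0\<^sub>v n" "A *\<^sub>v u = k \<cdot>\<^sub>v u"
    using ev A unfolding eigenvalue_def eigenvector_def by auto
  show thesis
  proof
    show "\<exists>a<n. Matrix.vec_index u a \<noteq> 0"
      using u(1,2) by (metis carrier_vecD eq_vecI index_zero_vec)
    show "(\<Sum>b<n. A $$ (a, b) * Matrix.vec_index u b) = k * Matrix.vec_index u a" if "a < n" for a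
      using arg_cong[OF u(3), of "\<lambda>z. Matrix.vec_index z a"] that u(1) A
      by (simp add: scalar_prod_def atLeast0LessThan)
  qed
qed

text \<open>This is what gives \<open>Min\<close> and \<open>Max\<close> of the spectrum a meaning.
  A complex eigenvalue always exists; the Hermitian form of a real symmetric matrix takes real
  values, which makes that eigenvalue real and a root of the real characteristic polynomial.\<close>

lemma spectrum_symmetric_nonempty:
  fixes A :: "real Matrix.mat"
  assumes A: "A \<in> carrier_mat n n" and n: "0 < n"
    and sym: "\<And>a b. a < n \<Longrightarrow> b < n \<Longrightarrow> A $$ (a, b) = A $$ (b, a)"
  shows "spectrum A \<noteq> {}"
proof -
  define C :: "complex Matrix.mat" where "C = map_mat of_real A"
  have C: "C \<in> carrier_mat n n" using A by (simp add: C_def)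
  obtain k where k: "eigenvalue C k"
    using spectrum_non_empty[OF C n] unfolding spectrum_def by auto
  obtain v where v: "\<exists>a<n. v a \<noteq> 0"
    and ev: "\<And>a. a < n \<Longrightarrow> (\<Sum>b<n. C $$ (a, b) * v b) = k * v a"
    using eigenvalue_coordinatesE[OF C k] by metis
  have Cab: "C $$ (a, b) = of_real (A $$ (a, b))" if "a < n" "b < n" for a b
    using that A by (simp add: C_def)
  define h where "h = (\<Sum>a<n. \<Sum>b<n. cnj (v a) * C $$ (a, b) * v b)"
  define t where "t = (\<Sum>a<n. (cmod (v a))\<^sup>2)"
  have hk: "h = k * of_real t"
  proof -
    have "h = (\<Sum>a<n. cnj (v a) * (\<Sum>b<n. C $$ (a, b) * v b))"
      by (simp add: h_def sum_distrib_left mult.assoc)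
    also have "\<dots> = (\<Sum>a<n. cnj (v a) * (k * v a))"
      by (simp add: ev)
    also have "\<dots> = (\<Sum>a<n. k * of_real ((cmod (v a))\<^sup>2))"
      by (simp add: complex_norm_square mult_ac del: of_real_power)
    finally show ?thesis by (simp add: t_def sum_distrib_left)
  qed
  \<comment> \<open>Conjugation fixes the real entries and exchanges the two vector factors;
    symmetry and swapping the sums then restore \<open>h\<close>.\<close>
  have "cnj h = (\<Sum>a<n. \<Sum>b<n. cnj (v b) * C $$ (b, a) * v a)"
    unfolding h_def cnj_sum by (intro sum.cong refl) (simp add: Cab sym mult_ac)
  also have "\<dots> = h"
    unfolding h_def by (rule sum.swap)
  finally have "cnj h = h" .
  moreover have "t > 0"
  proof -
    obtain a where "a < n" "v a \<noteq> 0" using v by blast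
    then show ?thesis unfolding t_def by (intro sum_pos2[of _ a]) auto
  qed
  ultimately have "cnj k = k" unfolding hk by auto
  then obtain r where r: "k = of_real r" by (metis Reals_cnj_iff Reals_cases)
  \<comment> \<open>The characteristic polynomial of \<open>C\<close> is the image of that of
    \<open>A\<close>, so the root descends to the reals.\<close>
  have "poly (map_poly of_real (char_poly A)) (of_real r :: complex) = 0"
    using k unfolding eigenvalue_root_char_poly[OF C] r
    by (simp add: C_def of_real_hom.char_poly_hom[OF A])
  then have "poly (char_poly A) r = 0"
    by simp
  then show ?thesis
    using spectrum_root_char_poly[OF A] by blast
qed

lemma chi_mat_spectrum:
  assumes w: "suitable_weight \<Omega> w" and e: "orthonormal_basis_polys \<Omega> w q n e"
  shows "finite (spectrum (chi_mat \<Omega> w q n e i))" "spectrum (chi_mat \<Omega> w q n e i) \<noteq> {}"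
proof -
  show "finite (spectrum (chi_mat \<Omega> w q n e i))"
    by (rule card_finite_spectrum(1)[OF chi_mat_carrier])
  \<comment> \<open>An empty basis could not represent the constant polynomial 1.\<close>
  have "n \<noteq> 0"
  proof
    assume "n = 0"
    moreover obtain c where "(\<lambda>x :: real ^ 'a. 1 :: real) = (\<lambda>x. \<Sum>a<n. c a * e a x)"
      using e const_in_polys[of 1 q] unfolding orthonormal_basis_polys_def by blast
    ultimately show False by (auto dest: fun_cong)
  qed
  then show "spectrum (chi_mat \<Omega> w q n e i) \<noteq> {}"
    by (intro spectrum_symmetric_nonempty[OF chi_mat_carrier])
      (auto simp: chi_mat_entry[OF w e] intro: wprod_swap)
qed

lemma chi_mat_eigenpolyE:
  assumes w: "suitable_weight \<Omega> w" and e: "orthonormal_basis_polys \<Omega> w q n e"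
    and k: "k \<in> spectrum (chi_mat \<Omega> w q n e i)"
  obtains p where "p \<in> polys q" "p \<noteq> (\<lambda>x. 0)"
    "wprod \<Omega> w p (\<lambda>x. x $ i * p x) = k * wprod \<Omega> w p p"
proof -
  let ?A = "chi_mat \<Omega> w q n e i"
  have ein: "e b \<in> polys q" if "b < n" for b
    using e that unfolding orthonormal_basis_polys_def by blast
  obtain v where v: "\<exists>a<n. v a \<noteq> 0"
    and ev: "\<And>a. a < n \<Longrightarrow> (\<Sum>b<n. ?A $$ (a, b) * v b) = k * v a"
    using eigenvalue_coordinatesE[OF chi_mat_carrier] k unfolding spectrum_def by (metis mem_Collect_eq)
  define p where "p = (\<lambda>x. \<Sum>b<n. v b * e b x)"
  have p: "p \<in> polys q"
    unfolding p_def using ein by (intro polys_sum polys_cmult) auto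
  have ep: "wprod \<Omega> w (e a) p = v a" if "a < n" for a
    unfolding p_def by (rule wprod_basis_sum[OF w e that])
  \<comment> \<open>\<open>f\<close> may have degree above \<open>q\<close>: only \<open>p\<close>
    is expanded in the basis. This matters for \<open>x $ i * p x\<close>, which can lie outside
    \<open>polys q\<close>.\<close>
  have expand: "wprod \<Omega> w f p = (\<Sum>a<n. v a * wprod \<Omega> w (e a) f)" if "f \<in> polys m" for f m
  proof -
    have "wprod \<Omega> w f p = (\<Sum>a<n. v a * wprod \<Omega> w f (e a))"
      unfolding p_def using ein by (intro wprod_sum_right[OF w that]) auto
    then show ?thesis by (simp add: wprod_commute)
  qed
  have exp: "wprod \<Omega> w (e a) (\<lambda>x. x $ i * p x) = k * v a" if "a < n" for a
  proof -
    \<comment> \<open>The coordinate factor moves from \<open>p\<close> to \<open>e a\<close>, so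
      that expanding \<open>p\<close> produces row \<open>a\<close> of the matrix applied to
      \<open>v\<close>.\<close>
    have "wprod \<Omega> w (e a) (\<lambda>x. x $ i * p x) = wprod \<Omega> w p (\<lambda>x. x $ i * e a x)"
      by (rule wprod_swap)
    also have "\<dots> = wprod \<Omega> w (\<lambda>x. x $ i * e a x) p"
      by (rule wprod_commute)
    also have "\<dots> = (\<Sum>b<n. v b * wprod \<Omega> w (e b) (\<lambda>x. x $ i * e a x))"
      by (rule expand[OF coordinate_mult_in_polys[OF ein[OF that]]])
    also have "\<dots> = (\<Sum>b<n. ?A $$ (a, b) * v b)"
      using that by (intro sum.cong)
        (auto simp: chi_mat_entry[OF w e] wprod_swap[of \<Omega> w "e a"])
    finally show ?thesis using ev[OF that] by simp
  qed
  show thesis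
  proof
    show "p \<in> polys q" by (rule p)
    show "p \<noteq> (\<lambda>x. 0)"
    proof
      assume "p = (\<lambda>x. 0)"
      then have "v a = 0" if "a < n" for a
        using ep[OF that] by (simp add: wprod_def set_lebesgue_integral_def)
      then show False using v by blast
    qed
    have "wprod \<Omega> w p (\<lambda>x. x $ i * p x) = wprod \<Omega> w (\<lambda>x. x $ i * p x) p"
      by (rule wprod_commute)
    also have "\<dots> = (\<Sum>a<n. v a * wprod \<Omega> w (e a) (\<lambda>x. x $ i * p x))"
      by (rule expand[OF coordinate_mult_in_polys[OF p]])
    also have "\<dots> = (\<Sum>a<n. v a * (k * wprod \<Omega> w (e a) p))"
      by (simp add: exp ep)
    also have "\<dots> = k * wprod \<Omega> w p p"
      by (simp add: expand[OF p] sum_distrib_left mult.left_commute)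
    finally show "wprod \<Omega> w p (\<lambda>x. x $ i * p x) = k * wprod \<Omega> w p p" .
  qed
qed

section \<open>Nodes on both sides of an eigenvalue\<close>

text \<open>The weighted deviations from the mean \<open>k\<close> sum to zero, which is impossible
  if all of them lie strictly on one side and some weight is positive.\<close>

lemma weighted_mean_between:
  fixes c y :: "'a \<Rightarrow> real"
  assumes S: "finite S" and c: "\<And>j. j \<in> S \<Longrightarrow> 0 \<le> c j" and pos: "0 < (\<Sum>j\<in>S. c j)"
    and mean: "(\<Sum>j\<in>S. c j * y j) = k * (\<Sum>j\<in>S. c j)"
  shows "\<exists>j\<in>S. y j \<le> k" "\<exists>j\<in>S. k \<le> y j"
proof -
  have zero: "(\<Sum>j\<in>S. c j * (y j - k)) = 0"
    using mean by (simp add: right_diff_distrib sum_subtractf sum_distrib_left mult.commute)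
  obtain a where a: "a \<in> S" "c a \<noteq> 0"
    using pos by (metis less_irrefl sum.neutral)
  then have ca: "0 < c a" using c by force
  show "\<exists>j\<in>S. y j \<le> k"
  proof (rule ccontr)
    assume "\<not> ?thesis"
    then have "k < y j" if "j \<in> S" for j using that by auto
    then have "0 < (\<Sum>j\<in>S. c j * (y j - k))"
      using a(1) ca c by (intro sum_pos2[OF S, of a]) (auto simp: less_imp_le)
    then show False using zero by simp
  qed
  show "\<exists>j\<in>S. k \<le> y j"
  proof (rule ccontr)
    assume "\<not> ?thesis"
    then have "y j < k" if "j \<in> S" for j using that by auto
    then have "0 < (\<Sum>j\<in>S. c j * (k - y j))"
      using a(1) ca c by (intro sum_pos2[OF S, of a]) (auto simp: less_imp_le)
    moreover have "(\<Sum>j\<in>S. c j * (k - y j)) = - (\<Sum>j\<in>S. c j * (y j - k))"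
      by (simp add: sum_negf[symmetric] algebra_simps)
    ultimately show False using zero by simp
  qed
qed

lemma cubature_nodes_around_eigenvalue:
  assumes w: "suitable_weight \<Omega> w" and e: "orthonormal_basis_polys \<Omega> w q n e"
    and pos: "\<And>\<alpha>. \<alpha> \<in> {1..N} \<Longrightarrow> 0 < wt \<alpha>"
    and exact: "\<And>f. f \<in> polys (2 * q + 1) \<Longrightarrow> cubature_exact \<Omega> w N node wt f"
    and k: "k \<in> spectrum (chi_mat \<Omega> w q n e i)"
  shows "\<exists>\<alpha>\<in>{1..N}. node \<alpha> $ i \<le> k" "\<exists>\<beta>\<in>{1..N}. k \<le> node \<beta> $ i"
proof -
  obtain p where p: "p \<in> polys q" "p \<noteq> (\<lambda>x. 0)"
    and eig: "wprod \<Omega> w p (\<lambda>x. x $ i * p x) = k * wprod \<Omega> w p p"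
    using chi_mat_eigenpolyE[OF w e k] by metis
  \<comment> \<open>Here the degree of the rule enters: the product has degree at most
    \<open>q + (q + 1)\<close>, which is \<open>2 * q + 1\<close>.\<close>
  have rule: "wprod \<Omega> w p g = (\<Sum>\<alpha>=1..N. wt \<alpha> * (p (node \<alpha>) * g (node \<alpha>)))"
    if "g \<in> polys (q + 1)" for g
    using exact[of "\<lambda>x. p x * g x"] polys_mult[OF p(1) that]
    by (simp add: cubature_exact_def wprod_def mult.assoc mult_2)
  let ?c = "\<lambda>\<alpha>. wt \<alpha> * (p (node \<alpha>))\<^sup>2"
  have pp: "wprod \<Omega> w p p = (\<Sum>\<alpha>=1..N. ?c \<alpha>)"
    using rule[of p] polys_mono[OF _ p(1), of "q + 1"] by (simp add: power2_eq_square)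
  have xpp: "wprod \<Omega> w p (\<lambda>x. x $ i * p x) = (\<Sum>\<alpha>=1..N. ?c \<alpha> * (node \<alpha> $ i))"
    using rule[OF coordinate_mult_in_polys[OF p(1)]] by (simp add: power2_eq_square mult_ac)
  have nonneg: "0 \<le> ?c \<alpha>" if "\<alpha> \<in> {1..N}" for \<alpha>
    using pos[OF that] by simp
  \<comment> \<open>\<open>p\<close> may vanish at some nodes, so single coefficients can be zero;
    by exactness their sum is the squared norm of \<open>p\<close>, which is positive.\<close>
  have total: "0 < (\<Sum>\<alpha>=1..N. ?c \<alpha>)"
    using wprod_self_pos[OF w p] pp by simp
  have mean: "(\<Sum>\<alpha>=1..N. ?c \<alpha> * (node \<alpha> $ i)) = k * (\<Sum>\<alpha>=1..N. ?c \<alpha>)"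
    using eig pp xpp by simp
  show "\<exists>\<alpha>\<in>{1..N}. node \<alpha> $ i \<le> k" "\<exists>\<beta>\<in>{1..N}. k \<le> node \<beta> $ i"
    using weighted_mean_between[OF _ nonneg total mean] by simp_all
qed

theorem theorem13:
  fixes \<Omega> :: "(real ^ 'd) set"
    and w :: "real ^ 'd \<Rightarrow> real"
    and q n N :: nat
    and e :: "nat \<Rightarrow> real ^ 'd \<Rightarrow> real"
    and node :: "nat \<Rightarrow> real ^ 'd"
    and wt :: "nat \<Rightarrow> real"
    and i :: 'd
  assumes "suitable_weight \<Omega> w"
    and "orthonormal_basis_polys \<Omega> w q n e"
    and "positive_cubature_rule \<Omega> w (2 * q + 1) N node wt"
  shows "(\<exists>\<alpha>\<in>{1..N}. node \<alpha> $ i \<le> Min (spectrum (chi_mat \<Omega> w q n e i))) \<and>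
         (\<exists>\<beta>\<in>{1..N}. Max (spectrum (chi_mat \<Omega> w q n e i)) \<le> node \<beta> $ i)"
  \<comment> \<open>The minimum and maximum of a finite nonempty spectrum are themselves
    eigenvalues, so each can serve as \<open>k\<close>.\<close>
  using cubature_nodes_around_eigenvalue[OF assms(1,2)] assms(3)
    Min_in[OF chi_mat_spectrum[OF assms(1,2)]] Max_in[OF chi_mat_spectrum[OF assms(1,2)]]
  unfolding positive_cubature_rule_def by metis

end
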